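(* Let $n\ge 0$ be an integer and let $Z_n$ be the number of zeros of a random lattice path $P_n$ of length $n$ (chosen according to the model in the context). Then $$\mathbb{E}(Z_n)=H^{\mathrm{odd}}_{n+1}.$$
   Context: $H^{\mathrm{odd}}_n=\sum_{1\le m\le n,\ m\text{ odd}}\frac1m$. Random path model: for an integer $n\ge0$, a random path $P_n$ on the lattice $\mathbb{Z}^2$ with steps $(1,+1)$ and $(1,-1)$, ending in $(n,0)$, is chosen as follows. First choose a starting point $(0,S)$ with $S$ uniformly distributed in $\{-n,-n+2,\dots,n-2,n\}$. Then choose a path uniformly at random among all paths from $(0,S)$ to $(n,0)$. A zero of $P_n$ is a lattice point $(x,0)\in P_n$ visited by the path (including the starting point if $S=0$ and the end point $(n,0)$). *)

theory Defs
  imports "HOL-Probability.Probability"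
begin

definition H_odd :: "nat \<Rightarrow> real" where
  "H_odd n = (\<Sum>m | 1 \<le> m \<and> m \<le> n \<and> odd m. 1 / real m)"

text \<open>A path is the list of the lattice points that it visits, in order.\<close>

definition lattice_path :: "(int \<times> int) list \<Rightarrow> bool" where
  "lattice_path P \<longleftrightarrow> P \<noteq> [] \<and>
     (\<forall>i. Suc i < length P \<longrightarrow> P ! Suc i - P ! i \<in> {(1, 1), (1, - 1)})"

definition paths_between :: "int \<times> int \<Rightarrow> int \<times> int \<Rightarrow> (int \<times> int) list set" where
  "paths_between A B = {P. lattice_path P \<and> hd P = A \<and> last P = B}"

definition start_heights :: "nat \<Rightarrow> int set" where
  "start_heights n = {2 * int k - int n | k. k \<le> n}"

definition random_path :: "nat \<Rightarrow> (int \<times> int) list pmf" where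
  "random_path n = bind_pmf (pmf_of_set (start_heights n))
     (\<lambda>s. pmf_of_set (paths_between (0, s) (int n, 0)))"

definition zeros :: "(int \<times> int) list \<Rightarrow> (int \<times> int) set" where
  "zeros P = {p \<in> set P. snd p = 0}"

definition num_zeros :: "(int \<times> int) list \<Rightarrow> nat" where
  "num_zeros P = card (zeros P)"

text \<open>The constant \<^const>\<open>pmf_of_set\<close> is the uniform distribution only on finite nonempty sets;
  the following facts show that both of its uses above are of this kind.\<close>

lemma finite_start_heights: "finite (start_heights n)"
  unfolding start_heights_def by simp

lemma start_heights_nonempty: "start_heights n \<noteq> {}"
  unfolding start_heights_def by auto

lemma lattice_path_nth:
  assumes "lattice_path P" "i < length P"
  shows "fst (P ! i) = fst (P ! 0) + int i \<and> \<bar>snd (P ! i) - snd (P ! 0)\<bar> \<le> int i"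
  using assms(2)
proof (induction i)
  case 0
  then show ?case by simp
next
  case (Suc i)
  have "P ! Suc i - P ! i \<in> {(1, 1), (1, - 1)}"
    using assms(1) Suc.prems unfolding lattice_path_def by blast
  moreover have "i < length P" using Suc.prems by simp
  ultimately show ?case using Suc.IH
    by (auto simp: prod_eq_iff)
qed

lemma finite_paths_between: "finite (paths_between (0, s) (int n, 0))"
proof (rule finite_subset)
  show "paths_between (0, s) (int n, 0) \<subseteq>
    {P. set P \<subseteq> {0..int n} \<times> {s - int n..s + int n} \<and> length P = Suc n}"
  proof
    fix P assume "P \<in> paths_between (0, s) (int n, 0)"
    then have P: "lattice_path P" "hd P = (0, s)" "last P = (int n, 0)" "P \<noteq> []"
      by (auto simp: paths_between_def lattice_path_def)
    then have z: "P ! 0 = (0, s)" and l: "P ! (length P - 1) = (int n, 0)"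
      by (simp_all add: hd_conv_nth last_conv_nth)
    have "length P - 1 < length P" using P(4) by simp
    from lattice_path_nth[OF P(1) this] have "int n = int (length P - 1)"
      unfolding z l by simp
    with P(4) have len: "length P = Suc n"
      by (metis Suc_diff_1 length_greater_0_conv of_nat_eq_iff)
    have "P ! i \<in> {0..int n} \<times> {s - int n..s + int n}" if "i < length P" for i
      using lattice_path_nth[OF P(1) that] z that len
      by (cases "P ! i") auto
    then have "set P \<subseteq> {0..int n} \<times> {s - int n..s + int n}"
      unfolding set_conv_nth by blast
    then show "P \<in> {P. set P \<subseteq> {0..int n} \<times> {s - int n..s + int n} \<and> length P = Suc n}"
      using len by blast
  qed
qed (intro finite_lists_length_eq, simp)

lemma paths_between_nonempty:
  assumes "s \<in> start_heights n"
  shows "paths_between (0, s) (int n, 0) \<noteq> {}"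
proof -
  obtain k where k: "s = 2 * int k - int n" "k \<le> n"
    using assms by (auto simp: start_heights_def)
  define P where
    "P = map (\<lambda>i. (int i, s + min (int i) (2 * int (n - k) - int i))) [0..<Suc n]"
  have nth: "P ! i = (int i, s + min (int i) (2 * int (n - k) - int i))" if "i \<le> n" for i
    using that unfolding P_def by (simp del: upt_Suc)
  have len: "length P = Suc n" by (simp add: P_def)
  then have ne: "P \<noteq> []" by auto
  have "lattice_path P"
    unfolding lattice_path_def
  proof (intro conjI allI impI)
    fix i assume "Suc i < length P"
    then have "i \<le> n" "Suc i \<le> n" using len by simp_all
    then show "P ! Suc i - P ! i \<in> {(1, 1), (1, - 1)}"
      by (simp add: nth min_def)
  qed (fact ne)
  moreover have "hd P = (0, s)" using ne nth[of 0] by (simp add: hd_conv_nth)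
  moreover have "last P = (int n, 0)"
    using ne len nth[of n] k by (simp add: last_conv_nth of_nat_diff)
  ultimately show ?thesis unfolding paths_between_def by blast
qed

end

theory Submission
  imports Defs
begin

text \<open>Read backwards from \<^term>\<open>(int n, 0)\<close>, the random path is a Polya urn process: deleting
  the first point of \<open>P\<^bsub>n+1\<^esub>\<close> leaves a (shifted) copy of \<open>P\<^bsub>n\<^esub>\<close>, because
  \<open>1 / C(n+1,k) + 1 / C(n+1,k+1) = (n+2) / ((n+1) C(n,k))\<close>. Hence the expected numbers of
  zeros for \<open>n+1\<close> and for \<open>n\<close> differ by the probability that \<open>P\<^bsub>n+1\<^esub>\<close> starts
  at height 0, which is \<open>1/(n+2)\<close> if \<open>n+1\<close> is even and 0 otherwise.\<close>

lemma lattice_path_Cons: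
  "lattice_path (p # P) \<longleftrightarrow> P = [] \<or> lattice_path P \<and> hd P - p \<in> {(1, 1), (1, - 1)}"
proof (cases "P = []")
  case False
  have all_nat: "(\<forall>i. R i) \<longleftrightarrow> R 0 \<and> (\<forall>i. R (Suc i))" for R :: "nat \<Rightarrow> bool"
    by (metis nat.exhaust)
  have "(\<forall>i. Suc i < length (p # P) \<longrightarrow> (p # P) ! Suc i - (p # P) ! i \<in> {(1, 1), (1, - 1)}) \<longleftrightarrow>
      hd P - p \<in> {(1, 1), (1, - 1)} \<and>
      (\<forall>i. Suc i < length P \<longrightarrow> P ! Suc i - P ! i \<in> {(1, 1), (1, - 1)})"
    using False by (subst all_nat) (simp add: hd_conv_nth)
  with False show ?thesis unfolding lattice_path_def by blast
qed (simp add: lattice_path_def)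

lemma fst_hd_le_lattice_path:
  assumes "lattice_path P" "p \<in> set P"
  shows "fst (hd P) \<le> fst p"
proof -
  obtain i where i: "i < length P" "p = P ! i"
    using assms(2) by (auto simp: in_set_conv_nth)
  then have "P \<noteq> []" by auto
  then show ?thesis using lattice_path_nth[OF assms(1) i(1)] i(2) by (simp add: hd_conv_nth)
qed

lemma paths_between_same_abscissa:
  "paths_between (a, s) (a, t) = (if s = t then {[(a, s)]} else {})"
proof -
  have "P = [(a, s)] \<and> s = t" if "P \<in> paths_between (a, s) (a, t)" for P
  proof -
    from that have P: "lattice_path P" "hd P = (a, s)" "last P = (a, t)" "P \<noteq> []"
      by (auto simp: paths_between_def lattice_path_def)
    have "length P - 1 < length P" using P(4) by simp
    from lattice_path_nth[OF P(1) this] P have "length P - 1 = 0"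
      by (simp add: hd_conv_nth last_conv_nth)
    then obtain p where "P = [p]" using P(4) by (cases P) auto
    with P show ?thesis by simp
  qed
  moreover have "[(a, s)] \<in> paths_between (a, s) (a, s)"
    by (simp add: paths_between_def lattice_path_def)
  ultimately show ?thesis by auto
qed

text \<open>First-step decomposition: since \<open>a < b\<close>, the path has at least two points,
  and its tail is again a path to the same end point.\<close>

lemma paths_between_step:
  assumes "a < b"
  shows "paths_between (a, s) (b, t) =
    Cons (a, s) ` (paths_between (a + 1, s + 1) (b, t) \<union> paths_between (a + 1, s - 1) (b, t))"
proof (intro equalityI subsetI)
  fix P assume P: "P \<in> paths_between (a, s) (b, t)"
  then have "P \<noteq> []" by (auto simp: paths_between_def lattice_path_def)
  with P obtain Q where Q: "P = (a, s) # Q"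
    by (cases P) (auto simp: paths_between_def)
  with P assms have "Q \<noteq> []" by (auto simp: paths_between_def)
  with P Q have "Q \<in> paths_between (a + 1, s + 1) (b, t) \<union> paths_between (a + 1, s - 1) (b, t)"
    by (auto simp: paths_between_def lattice_path_Cons prod_eq_iff)
  with Q show "P \<in> Cons (a, s) `
      (paths_between (a + 1, s + 1) (b, t) \<union> paths_between (a + 1, s - 1) (b, t))" by blast
next
  fix P assume "P \<in> Cons (a, s) `
      (paths_between (a + 1, s + 1) (b, t) \<union> paths_between (a + 1, s - 1) (b, t))"
  then obtain Q where "P = (a, s) # Q"
    "Q \<in> paths_between (a + 1, s + 1) (b, t) \<union> paths_between (a + 1, s - 1) (b, t)" by blast
  moreover from this(2) have "Q \<noteq> []" by (auto simp: paths_between_def lattice_path_def)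
  ultimately show "P \<in> paths_between (a, s) (b, t)"
    by (auto simp: paths_between_def lattice_path_Cons prod_eq_iff)
qed

lemma finite_paths_between_shift: "finite (paths_between (a, s) (a + int n, t))"
proof (induction n arbitrary: a s)
  case (Suc n)
  have "finite (paths_between (a + 1, s') (a + int (Suc n), t))" for s'
    using Suc.IH[of "a + 1" s'] by (simp add: algebra_simps)
  then show ?case by (subst paths_between_step) auto
qed (simp add: paths_between_same_abscissa)

text \<open>Each step changes the height by exactly 1. This disposes of the boundary indices below,
  where the start is too far from height 0 to return.\<close>

lemma paths_between_empty:
  assumes "int n < \<bar>s - t\<bar>"
  shows "paths_between (a, s) (a + int n, t) = {}"
  using assms
proof (induction n arbitrary: a s)
  case (Suc n)
  have "paths_between (a + 1, s + 1) (a + int (Suc n), t) = {}"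
    "paths_between (a + 1, s - 1) (a + int (Suc n), t) = {}"
    using Suc.IH[of "s + 1" "a + 1"] Suc.IH[of "s - 1" "a + 1"] Suc.prems
    by (auto simp: algebra_simps)
  then show ?case by (subst paths_between_step) auto
qed (simp add: paths_between_same_abscissa)

text \<open>The two families of tails are disjoint because their heads differ. With \<open>f\<close>
  constantly 1 this yields the count of paths, with \<open>num_zeros\<close> the count of
  zeros.\<close>

lemma sum_paths_between_step:
  fixes f :: "(int \<times> int) list \<Rightarrow> 'a::comm_monoid_add"
  shows "sum f (paths_between (a, s) (a + int (Suc n), t)) =
    (\<Sum>P\<in>paths_between (a + 1, s + 1) (a + 1 + int n, t). f ((a, s) # P)) +
    (\<Sum>P\<in>paths_between (a + 1, s - 1) (a + 1 + int n, t). f ((a, s) # P))"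
proof -
  let ?U = "paths_between (a + 1, s + 1) (a + 1 + int n, t)"
  let ?D = "paths_between (a + 1, s - 1) (a + 1 + int n, t)"
  have "paths_between (a, s) (a + int (Suc n), t) = Cons (a, s) ` (?U \<union> ?D)"
    using paths_between_step[of a "a + int (Suc n)" s t] by (simp add: algebra_simps)
  moreover have "?U \<inter> ?D = {}" by (auto simp: paths_between_def)
  ultimately show ?thesis
    by (simp add: sum.reindex inj_on_def sum.union_disjoint finite_paths_between_shift)
qed

text \<open>Starting at height \<open>2 * int k - int n\<close>, a path must make \<open>k\<close>
  down-steps and \<open>n - k\<close> up-steps. The recursion is Pascal's rule: an up-step keeps
  \<open>k\<close>, a down-step lowers it by one.\<close>

lemma card_paths_between:
  "card (paths_between (a, 2 * int k - int n) (a + int n, 0)) = n choose k"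
proof (induction n arbitrary: a k)
  case 0
  then show ?case by (cases k) (simp_all add: paths_between_same_abscissa)
next
  case (Suc n)
  have step: "card (paths_between (a, 2 * int k - int (Suc n)) (a + int (Suc n), 0)) =
      card (paths_between (a + 1, 2 * int k - int n) (a + 1 + int n, 0)) +
      card (paths_between (a + 1, 2 * (int k - 1) - int n) (a + 1 + int n, 0))"
    unfolding card_eq_sum sum_paths_between_step by (simp add: algebra_simps)
  show ?case
  proof (cases k)
    case 0
    \<comment> \<open>A down-step would lead to height \<open>- int n - 2\<close>, out of reach of 0
      in \<open>n\<close> steps.\<close>
    then show ?thesis unfolding step using Suc.IH[of "a + 1" 0]
      by (simp add: paths_between_empty)
  next
    case (Suc j)
    then show ?thesis unfolding step using Suc.IH[of "a + 1" k] Suc.IH[of "a + 1" j] by simp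
  qed
qed

text \<open>\<open>num_zeros\<close> counts a set of points, so additivity needs the new point to
  differ from all later ones; the abscissas increase strictly along a path.\<close>

lemma num_zeros_Cons:
  assumes "P \<in> paths_between (a + 1, s') B"
  shows "num_zeros ((a, s) # P) = of_bool (s = 0) + num_zeros P"
proof -
  have "lattice_path P" "fst (hd P) = a + 1" using assms by (auto simp: paths_between_def)
  then have "(a, s) \<notin> set P" using fst_hd_le_lattice_path by fastforce
  moreover have "zeros ((a, s) # P) = (if s = 0 then insert (a, s) (zeros P) else zeros P)"
    by (auto simp: zeros_def)
  moreover have "finite (zeros P)" by (simp add: zeros_def)
  moreover have "(a, s) \<notin> zeros P" using calculation(1) by (simp add: zeros_def)
  ultimately show ?thesis by (auto simp: num_zeros_def)
qed

text \<open>Divided by \<open>n choose k\<close>, this is the expected number of zeros given the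
  start height. The abscissa \<open>a\<close> is a parameter because deleting the first point moves
  the start to the right while the end stays fixed.\<close>

definition total_zeros :: "int \<Rightarrow> nat \<Rightarrow> nat \<Rightarrow> nat" where
  "total_zeros a n k =
    (\<Sum>P\<in>paths_between (a, 2 * int k - int n) (a + int n, 0). num_zeros P)"

lemma total_zeros_eq_0:
  assumes "n < k"
  shows "total_zeros a n k = 0"
  using assms by (simp add: total_zeros_def paths_between_empty)

lemma total_zeros_Suc:
  "total_zeros a (Suc n) k = of_bool (2 * k = Suc n) * (Suc n choose k) +
    total_zeros (a + 1) n k + (case k of 0 \<Rightarrow> 0 | Suc j \<Rightarrow> total_zeros (a + 1) n j)"
proof -
  let ?s = "2 * int k - int (Suc n)"
  let ?U = "paths_between (a + 1, ?s + 1) (a + 1 + int n, 0)"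
  let ?D = "paths_between (a + 1, ?s - 1) (a + 1 + int n, 0)"
  have s: "?s = 0 \<longleftrightarrow> 2 * k = Suc n" by linarith
  have card: "Suc n choose k = card ?U + card ?D"
    using card_paths_between[of a k "Suc n"] unfolding card_eq_sum sum_paths_between_step by simp
  have "total_zeros a (Suc n) k =
      (\<Sum>P\<in>?U. of_bool (?s = 0) + num_zeros P) + (\<Sum>P\<in>?D. of_bool (?s = 0) + num_zeros P)"
    unfolding total_zeros_def sum_paths_between_step
    by (intro arg_cong2[where f = "(+)"] sum.cong refl num_zeros_Cons)
  also have "\<dots> = of_bool (?s = 0) * (Suc n choose k) + sum num_zeros ?U + sum num_zeros ?D"
    unfolding card by (simp only: sum.distrib sum_constant) (simp add: algebra_simps)
  also have "sum num_zeros ?U = total_zeros (a + 1) n k"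
    by (simp add: total_zeros_def)
  \<comment> \<open>The value 0 for \<open>k = 0\<close> is the sum over an empty set of
    paths.\<close>
  also have "sum num_zeros ?D = (case k of 0 \<Rightarrow> 0 | Suc j \<Rightarrow> total_zeros (a + 1) n j)"
    by (cases k) (simp_all add: total_zeros_def paths_between_empty)
  finally show ?thesis unfolding s .
qed

text \<open>The absorption identities bring both fractions to the denominator
  \<open>(n + 1) * (n choose k)\<close>, with numerators \<open>n + 1 - k\<close> and
  \<open>k + 1\<close>, whose sum does not depend on \<open>k\<close>.\<close>

lemma inverse_binomial_add:
  assumes "k \<le> n"
  shows "1 / real (Suc n choose k) + 1 / real (Suc n choose Suc k) =
    real (n + 2) / (real (n + 1) * real (n choose k))"
proof -
  have 1: "real (Suc k) * real (Suc n choose Suc k) = real (Suc n) * real (n choose k)"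
    using Suc_times_binomial_eq[of n k] by (metis mult.commute of_nat_mult)
  have "(Suc n - k) * (Suc n choose k) = Suc n * (n choose k)"
    using binomial_absorb_comp[of "Suc n" k] by simp
  then have 2: "(real (Suc n) - real k) * real (Suc n choose k) = real (Suc n) * real (n choose k)"
    using assms by (metis le_SucI of_nat_diff of_nat_mult)
  have pos: "real (Suc n choose k) > 0" "real (Suc n choose Suc k) > 0" "real (n choose k) > 0"
    using assms by (simp_all add: zero_less_binomial del: binomial_Suc_Suc)
  have "1 / real (Suc n choose k) = (real (Suc n) - real k) / (real (Suc n) * real (n choose k))"
    using pos assms unfolding 2[symmetric] by simp
  moreover have "1 / real (Suc n choose Suc k) = real (Suc k) / (real (Suc n) * real (n choose k))"
    using pos unfolding 1[symmetric] by simp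
  ultimately show ?thesis by (simp add: add_divide_distrib[symmetric] del: binomial_Suc_Suc)
qed

lemma H_odd_Suc: "H_odd (Suc n) = H_odd n + of_bool (even n) / real (Suc n)"
proof -
  have "{m. 1 \<le> m \<and> m \<le> Suc n \<and> odd m} =
      (if even n then insert (Suc n) {m. 1 \<le> m \<and> m \<le> n \<and> odd m} else {m. 1 \<le> m \<and> m \<le> n \<and> odd m})"
    by (auto simp: le_Suc_eq)
  then show ?thesis by (simp add: H_odd_def)
qed

text \<open>The left side is \<open>n + 1\<close> times the expectation. Calling it S(n), the
  induction step is S(n+1) = [n odd] + (n+2)/(n+1) S(n).\<close>

lemma sum_total_zeros:
  "(\<Sum>k\<le>n. real (total_zeros a n k) / real (n choose k)) = real (n + 1) * H_odd (n + 1)"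
proof (induction n arbitrary: a)
  case 0
  have "{m. 1 \<le> m \<and> m \<le> Suc 0 \<and> odd m} = {1::nat}" by auto
  then show ?case
    by (simp add: total_zeros_def paths_between_same_abscissa num_zeros_def zeros_def H_odd_def
        Collect_conv_if conj_commute cong: conj_cong)
next
  case (Suc n)
  let ?T = "\<lambda>k. real (total_zeros (a + 1) n k)"
  let ?C = "\<lambda>k. real (Suc n choose k)"
  have "(\<Sum>k\<le>Suc n. real (total_zeros a (Suc n) k) / ?C k) =
      (\<Sum>k\<le>Suc n. of_bool (2 * k = Suc n)) + (\<Sum>k\<le>Suc n. ?T k / ?C k) +
      (\<Sum>k\<le>Suc n. (case k of 0 \<Rightarrow> 0 | Suc j \<Rightarrow> ?T j) / ?C k)"
    unfolding sum.distrib[symmetric]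
    by (intro sum.cong refl)
      (auto simp: total_zeros_Suc add_divide_distrib simp del: binomial_Suc_Suc split: nat.split)
  \<comment> \<open>Height 0 is a possible start exactly when \<open>Suc n\<close> is even, and then
    for a single \<open>k\<close>.\<close>
  also have "(\<Sum>k\<le>Suc n. of_bool (2 * k = Suc n) :: real) = of_bool (odd n)"
  proof -
    have "{k. k \<le> Suc n \<and> 2 * k = Suc n} = (if odd n then {Suc n div 2} else {})"
      by auto presburger
    then show ?thesis by (simp add: sum_of_bool_eq Int_def del: sum.atMost_Suc)
  qed
  also have "(\<Sum>k\<le>Suc n. ?T k / ?C k) = (\<Sum>k\<le>n. ?T k / ?C k)"
    by (simp add: total_zeros_eq_0)
  also have "(\<Sum>k\<le>Suc n. (case k of 0 \<Rightarrow> 0 | Suc j \<Rightarrow> ?T j) / ?C k) = (\<Sum>k\<le>n. ?T k / ?C (Suc k))"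
    by (simp add: sum.atMost_Suc_shift del: sum.atMost_Suc binomial_Suc_Suc)
  \<comment> \<open>Each tail class \<open>k\<close> arises twice: by an up-step from index
    \<open>k\<close> and by a down-step from index \<open>Suc k\<close>. Its total weight is
    therefore the sum of two reciprocal binomials.\<close>
  also have "of_bool (odd n) + (\<Sum>k\<le>n. ?T k / ?C k) + (\<Sum>k\<le>n. ?T k / ?C (Suc k)) =
      of_bool (odd n) + (\<Sum>k\<le>n. ?T k * (1 / ?C k + 1 / ?C (Suc k)))"
    by (simp add: sum.distrib distrib_left del: binomial_Suc_Suc)
  also have "(\<Sum>k\<le>n. ?T k * (1 / ?C k + 1 / ?C (Suc k))) =
      real (n + 2) / real (n + 1) * (\<Sum>k\<le>n. ?T k / real (n choose k))"
    unfolding sum_distrib_left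
    by (intro sum.cong refl) (simp add: inverse_binomial_add del: binomial_Suc_Suc)
  also have "\<dots> = real (n + 2) * H_odd (n + 1)"
    unfolding Suc.IH by (simp del: of_nat_Suc)
  also have "of_bool (odd n) + real (n + 2) * H_odd (n + 1) = real (Suc n + 1) * H_odd (Suc n + 1)"
    using H_odd_Suc[of "Suc n"] by (simp add: field_simps)
  finally show ?case .
qed

theorem theorem4p1:
  fixes n :: nat
  shows "measure_pmf.expectation (random_path n) (\<lambda>P. real (num_zeros P)) = H_odd (n + 1)"
proof -
  let ?h = "\<lambda>k. 2 * int k - int n"
  have heights: "start_heights n = ?h ` {..n}" by (auto simp: start_heights_def)
  have inj: "inj_on ?h {..n}" by (simp add: inj_on_def)
  have inner: "measure_pmf.expectation (pmf_of_set (paths_between (0, ?h k) (int n, 0)))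
      (\<lambda>P. real (num_zeros P)) = real (total_zeros 0 n k) / real (n choose k)" if "k \<le> n" for k
  proof -
    have "?h k \<in> start_heights n" using that unfolding heights by blast
    then show ?thesis
      using card_paths_between[of 0 k n]
      by (simp add: integral_pmf_of_set finite_paths_between paths_between_nonempty total_zeros_def)
  qed
  have "measure_pmf.expectation (random_path n) (\<lambda>P. real (num_zeros P)) =
      (\<Sum>s\<in>start_heights n. measure_pmf.expectation
        (pmf_of_set (paths_between (0, s) (int n, 0))) (\<lambda>P. real (num_zeros P))
        /\<^sub>R real (card (start_heights n)))"
    unfolding random_path_def
    by (intro pmf_expectation_bind_pmf_of_set finite_start_heights start_heights_nonempty)
      (simp add: finite_paths_between paths_between_nonempty)
  \<comment> \<open>The start heights are indexed injectively by \<open>k \<le> n\<close>, so each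
    has probability \<open>1 / (n + 1)\<close>.\<close>
  also have "\<dots> = (\<Sum>k\<le>n. real (total_zeros 0 n k) / real (n choose k)) / real (n + 1)"
    unfolding heights sum.reindex[OF inj] card_image[OF inj] sum_divide_distrib
    by (intro sum.cong) (simp_all add: inner divide_inverse)
  also have "\<dots> = H_odd (n + 1)"
    unfolding sum_total_zeros by (simp del: of_nat_Suc)
  finally show ?thesis .
qed

end
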